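(* Let $W$ and $R$ be positive integers and let $\epsilon>0$ satisfy $\epsilon^{-1}\le 2W\left(1-\frac{1}{\log W}\right)$. Set $\upsilon=\lceil\log(\epsilon^{-1}\log W)\rceil$ and $k=\left\lceil\frac{1}{2\epsilon-2^{-\upsilon}}\right\rceil$, and assume $\frac Wk$ is an integer. Then Algorithm 2 (described in the context, run with these parameters) provides an $RW\epsilon$-additive approximation for Basic-Summing; that is, for every input stream of integers in $\{0,1,\dots,R\}$ and at every time, the value $\widehat{S}$ returned by Query satisfies $|\widehat{S}-S|\le RW\epsilon$.
   Context: All logarithms are base 2. Basic-Summing: given a stream of integers in $\{0,1,\dots,R\}$ arriving one at a time, maintain the sum $S$ of the last $W$ elements (elements before the beginning of the stream are regarded as 0). For $z\in[0,1]$, $\mathrm{Round}_{\upsilon}(z)$ denotes rounding of $z$ to the nearest value $\widetilde z$ such that $2^{\upsilon}\widetilde z$ is an integer. Algorithm 2. Variables: a fixed-point number $y$, integers $B,i,m$ and a bit array $b=(b_0,\dots,b_{k-1})$, all initialized to $0$. Add(element $x$): first set $x'=\mathrm{Round}_{\upsilon}\left(\frac xR\right)$. If $m=\frac Wk-1$, then do in order: (1) $B\leftarrow B-b_i$; (2) if $y+x'\ge\frac Wk$, set $b_i\leftarrow1$ and $y\leftarrow y-\frac Wk+x'$; otherwise set $b_i\leftarrow0$ and $y\leftarrow y+x'$; (3) $B\leftarrow B+b_i$; (4) $m\leftarrow0$; (5) $i\leftarrow i+1\bmod k$. Otherwise (if $m\ne\frac Wk-1$): $y\leftarrow y+x'$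 and $m\leftarrow m+1$. Query: return $R\cdot\left(\frac Wk\cdot B+y-\frac W{2k}-m\cdot b_i\right)$. Each arriving stream element is processed by one call of Add.
   Formalization: W > 1 is assumed, since 1/log W is undefined at W = 1; rounded values must lie in [0,1], which only matters for υ = −1, where rounding 1 up to 2 would make the claim false (e.g. W = 4, ε = 4, constant stream R). *)

theory Defs
  imports Complex_Main
begin

text \<open>Every map sending \<open>z \<in> [0,1]\<close> to a nearest multiple of \<open>2\<^sup>-\<^sup>\<upsilon>\<close> is admitted, so no
  tie-breaking rule is fixed; \<open>\<upsilon>\<close> may be negative.  The rounded value is required to stay in
  \<open>[0,1]\<close>.  For \<open>\<upsilon> \<ge> 0\<close> and for \<open>\<upsilon> \<le> -2\<close> this is automatic; for \<open>\<upsilon> = -1\<close> it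
  only resolves the tie of \<open>1\<close> between \<open>0\<close> and \<open>2\<close> downwards.\<close>

definition is_rounding :: "int \<Rightarrow> (real \<Rightarrow> real) \<Rightarrow> bool" where
  "is_rounding \<upsilon> rnd \<longleftrightarrow>
     (\<forall>z\<in>{0..1}. 2 powi \<upsilon> * rnd z \<in> \<int> \<and> rnd z \<in> {0..1} \<and>
        (\<forall>w. 2 powi \<upsilon> * w \<in> \<int> \<longrightarrow> \<bar>rnd z - z\<bar> \<le> \<bar>w - z\<bar>))"

record summing_state =
  st_y :: real
  st_B :: int
  st_i :: nat
  st_m :: nat
  st_b :: "bool list"

definition init_state :: "nat \<Rightarrow> summing_state" where
  "init_state k = \<lparr>st_y = 0, st_B = 0, st_i = 0, st_m = 0, st_b = replicate k False\<rparr>"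

definition add_element ::
  "nat \<Rightarrow> nat \<Rightarrow> nat \<Rightarrow> (real \<Rightarrow> real) \<Rightarrow> nat \<Rightarrow> summing_state \<Rightarrow> summing_state" where
  "add_element W R k rnd x s =
    (let x' = rnd (real x / real R); n = real W / real k;
         y = st_y s; B = st_B s; i = st_i s; m = st_m s; b = st_b s
     in if real m = n - 1 then
          (let B1 = B - of_bool (b ! i);
               bit = (y + x' \<ge> n);
               y1 = (if bit then y - n + x' else y + x');
               B2 = B1 + of_bool bit
           in \<lparr>st_y = y1, st_B = B2, st_i = (i + 1) mod k, st_m = 0, st_b = b[i := bit]\<rparr>)
        else s\<lparr>st_y := y + x', st_m := m + 1\<rparr>)"

definition query :: "nat \<Rightarrow> nat \<Rightarrow> nat \<Rightarrow> summing_state \<Rightarrow> real" where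
  "query W R k s =
     real R * (real W / real k * real_of_int (st_B s) + st_y s - real W / (2 * real k)
               - real (st_m s) * of_bool (st_b s ! st_i s))"

text \<open>A list holds the elements that have arrived so far, the oldest first.\<close>

definition run :: "nat \<Rightarrow> nat \<Rightarrow> nat \<Rightarrow> (real \<Rightarrow> real) \<Rightarrow> nat list \<Rightarrow> summing_state" where
  "run W R k rnd xs = fold (add_element W R k rnd) xs (init_state k)"

definition window_sum :: "nat \<Rightarrow> nat list \<Rightarrow> nat" where
  "window_sum W xs = sum_list (drop (length xs - W) xs)"

text \<open>Since all finite lists are considered, the estimate is controlled at every time of every
  stream, including before the first arrival.\<close>

definition additive_approximation ::
  "nat \<Rightarrow> nat \<Rightarrow> real \<Rightarrow> (nat list \<Rightarrow> real) \<Rightarrow> bool" where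
  "additive_approximation W R E est \<longleftrightarrow>
     (\<forall>xs. set xs \<subseteq> {0..R} \<longrightarrow> \<bar>est xs - real (window_sum W xs)\<bar> \<le> E)"

end

theory Submission
  imports Defs
begin

text \<open>Let \<open>n = W/k\<close>, let \<open>\<delta> = 2\<^sup>-\<^sup>\<upsilon>\<close>, and let \<open>P\<close> be the prefix sums of the rounded stream.
  Since \<open>0 \<le> y < n\<close> whenever a block ends, the number of bits set during the first \<open>q\<close> blocks
  is \<open>c q = \<lfloor>P (q n) / n\<rfloor>\<close>; hence \<open>y = P N - n c q\<close> and \<open>B = c q - c (q - k)\<close>, where
  \<open>q\<close> is the number of blocks completed at time \<open>N\<close>.
  The error of the query against the rounded window sum is therefore
  \<open>y' + p - n/2 - m b\<^sub>i\<close>, where \<open>y'\<close> is the value of \<open>y\<close> at the start of the block whose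
  bit is \<open>b\<^sub>i\<close> and \<open>p\<close> is the sum of the first \<open>m\<close> rounded elements of that block.
  If \<open>b\<^sub>i = 0\<close>, then \<open>y' + p\<close> lies in \<open>[0,n]\<close>; if \<open>b\<^sub>i = 1\<close>, then it lies in \<open>[m, n + m]\<close>,
  because the other \<open>n - m\<close> elements contribute at most \<open>n - m\<close>.  So this error is at most \<open>n/2\<close>,
  rounding contributes at most \<open>W \<delta> / 2\<close>, and \<open>1/k \<le> 2 \<epsilon> - \<delta>\<close> by the choice of \<open>k\<close>.\<close>

lemma rounding_error:
  assumes "is_rounding \<upsilon> rnd" "z \<in> {0..1}"
  shows "\<bar>rnd z - z\<bar> \<le> 2 powi (- \<upsilon>) / 2"
proof -
  define p :: real where "p = 2 powi \<upsilon>"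
  have p: "p > 0" by (simp add: p_def)
  \<comment> \<open>The nearest grid point to \<open>z\<close>. It may lie outside
    \<open>[0,1]\<close>, but \<open>is_rounding\<close> compares \<open>rnd z\<close> with every
    multiple of the grid width.\<close>
  define w where "w = of_int (round (p * z)) / p"
  have "p * w \<in> \<int>" using p by (simp add: w_def)
  then have "\<bar>rnd z - z\<bar> \<le> \<bar>w - z\<bar>"
    using assms by (auto simp: is_rounding_def p_def)
  also have "w - z = (of_int (round (p * z)) - p * z) / p"
    using p by (simp add: w_def field_simps)
  also have "\<bar>\<dots>\<bar> \<le> (1 / 2) / p"
    unfolding abs_divide abs_of_pos[OF p] using p
    by (intro divide_right_mono of_int_round_abs_le) simp
  also have "\<dots> = 2 powi (- \<upsilon>) / 2"
    by (simp add: p_def power_int_minus field_simps)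
  finally show ?thesis .
qed

text \<open>The choice of \<open>\<upsilon>\<close> gives
  \<open>2 powi (- \<upsilon>) \<le> \<epsilon> / log 2 W\<close>; with this, the bound on
  \<open>1 / \<epsilon>\<close> becomes
  \<open>1 / (2 * \<epsilon> - 2 powi (- \<upsilon>)) \<le> W\<close>.\<close>

lemma block_count_bounds:
  fixes W k :: nat and \<epsilon> :: real and \<upsilon> :: int
  assumes "1 < W" "0 < \<epsilon>"
    and eps: "1 / \<epsilon> \<le> 2 * real W * (1 - 1 / log 2 (real W))"
    and \<upsilon>: "\<upsilon> = \<lceil>log 2 (1 / \<epsilon> * log 2 (real W))\<rceil>"
    and k: "int k = \<lceil>1 / (2 * \<epsilon> - 2 powi (- \<upsilon>))\<rceil>"
  shows "0 < k" "k \<le> W" "1 / real k \<le> 2 * \<epsilon> - 2 powi (- \<upsilon>)"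
proof -
  define L where "L = log 2 (real W)"
  define \<delta> :: real where "\<delta> = 2 powi (- \<upsilon>)"
  have L0: "L > 0" using assms(1) by (simp add: L_def)
  have "0 < 1 / \<epsilon>" using assms(2) by simp
  \<comment> \<open>A positive \<open>1 / \<epsilon>\<close> needs a positive bound, which forces
    \<open>L > 1\<close> and so excludes \<open>W = 2\<close>.\<close>
  then have "0 < 2 * real W * (1 - 1 / L)" using eps unfolding L_def by linarith
  then have "1 - 1 / L > 0" using assms(1) by (simp add: zero_less_mult_iff)
  then have L1: "L > 1" using L0 by (simp add: field_simps)
  have "log 2 (1 / \<epsilon> * L) \<le> real_of_int \<upsilon>"
    unfolding \<upsilon> L_def by linarith
  then have "1 / \<epsilon> * L \<le> 2 powr real_of_int \<upsilon>"
    using L0 assms(2) by (simp add: log_le_iff)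
  then have "1 / \<epsilon> * L \<le> 2 powi \<upsilon>"
    by (simp add: powr_real_of_int')
  then have "1 / \<epsilon> * L * \<delta> \<le> 2 powi \<upsilon> * \<delta>"
    by (intro mult_right_mono) (auto simp: \<delta>_def)
  also have "2 powi \<upsilon> * \<delta> = 1" by (simp add: \<delta>_def power_int_minus)
  finally have d: "\<delta> \<le> \<epsilon> / L" using L0 assms(2) by (simp add: field_simps)
  have "\<epsilon> / L < \<epsilon>" using L1 assms(2) by (simp add: field_simps)
  then have pos: "2 * \<epsilon> - \<delta> > 0" using d assms(2) by linarith
  have "1 \<le> 2 * real W * (1 - 1 / L) * \<epsilon>"
    using eps assms(2) unfolding L_def by (simp add: field_simps)
  also have "\<dots> = real W * (2 * \<epsilon> - 2 * (\<epsilon> / L))" by (simp add: algebra_simps)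
  also have "\<dots> \<le> real W * (2 * \<epsilon> - \<delta>)"
  proof (rule mult_left_mono)
    have "0 < \<epsilon> / L" using L0 assms(2) by simp
    then show "2 * \<epsilon> - 2 * (\<epsilon> / L) \<le> 2 * \<epsilon> - \<delta>" using d by linarith
  qed simp
  finally have W: "1 / (2 * \<epsilon> - \<delta>) \<le> real W" using pos by (simp add: field_simps)
  have kd: "int k = \<lceil>1 / (2 * \<epsilon> - \<delta>)\<rceil>" using k by (simp add: \<delta>_def)
  have "\<lceil>1 / (2 * \<epsilon> - \<delta>)\<rceil> \<le> int W" using W by (simp add: ceiling_le_iff)
  with kd show "k \<le> W" by simp
  have "0 < \<lceil>1 / (2 * \<epsilon> - \<delta>)\<rceil>" using pos by simp
  then show k0: "0 < k" unfolding kd[symmetric] by simp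
  have "1 / (2 * \<epsilon> - \<delta>) \<le> real_of_int (int k)" unfolding kd by linarith
  then show "1 / real k \<le> 2 * \<epsilon> - 2 powi (- \<upsilon>)"
    using pos k0 unfolding \<delta>_def[symmetric] by (simp add: field_simps)
qed

text \<open>A closed form, depending on the stream alone, for the number of bits set in the first
  \<open>q\<close> blocks. It is an \<open>int\<close> so that differences of carries are not
  truncated.\<close>

definition carry :: "nat \<Rightarrow> (nat \<Rightarrow> real) \<Rightarrow> nat \<Rightarrow> int" where
  "carry n g q = \<lfloor>(\<Sum>i<q * n. g i) / real n\<rfloor>"

lemma carry_0 [simp]: "carry n g 0 = 0"
  by (simp add: carry_def)

text \<open>The floor inequalities; they say that the \<open>y\<close> left over at a block end lies
  in \<open>[0,n)\<close>.\<close>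

lemma carry_bounds:
  assumes "0 < n"
  shows "real n * carry n g q \<le> (\<Sum>i<q * n. g i)"
    and "(\<Sum>i<q * n. g i) < real n * carry n g q + real n"
proof -
  define c where "c = carry n g q"
  have "real_of_int c \<le> (\<Sum>i<q * n. g i) / real n" "(\<Sum>i<q * n. g i) / real n < real_of_int c + 1"
    unfolding c_def carry_def by linarith+
  then show "real n * carry n g q \<le> (\<Sum>i<q * n. g i)"
    and "(\<Sum>i<q * n. g i) < real n * carry n g q + real n"
    using assms unfolding c_def[symmetric] by (simp_all add: field_simps)
qed

lemma partial_sum_bounds:
  fixes g :: "nat \<Rightarrow> real"
  assumes "\<And>i. g i \<in> {0..1}" "a \<le> b"
  shows "sum g {..<a} \<le> sum g {..<b}" "sum g {..<b} \<le> sum g {..<a} + real (b - a)"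
proof -
  have "sum g {..<b} = sum g {..<a} + sum g {a..<b}"
    using assms(2) by (metis sum.atLeastLessThan_concat lessThan_atLeast0 zero_le)
  moreover have "0 \<le> sum g {a..<b}"
    using assms(1) by (intro sum_nonneg) auto
  moreover have "sum g {a..<b} \<le> real (b - a)"
    using sum_bounded_above[of "{a..<b}" g 1] assms(1) by auto
  ultimately show "sum g {..<a} \<le> sum g {..<b}" "sum g {..<b} \<le> sum g {..<a} + real (b - a)"
    by auto
qed

text \<open>A remainder in \<open>[0,n)\<close> grows by at most \<open>n\<close> over a block, so
  it stays below \<open>2n\<close> and the floor rises by 0 or 1. The condition is the algorithm's
  own test.\<close>

lemma carry_Suc:
  assumes "0 < n" and g: "\<And>i. g i \<in> {0..1}"
  shows "carry n g (Suc q) =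
    carry n g q + of_bool (real n \<le> (\<Sum>i<Suc q * n. g i) - real n * carry n g q)"
proof -
  define c where "c = carry n g q"
  have "(\<Sum>i<q * n. g i) \<le> (\<Sum>i<Suc q * n. g i)"
    "(\<Sum>i<Suc q * n. g i) \<le> (\<Sum>i<q * n. g i) + real n"
    using partial_sum_bounds[OF g, of "q * n" "Suc q * n"] by auto
  moreover note carry_bounds[OF assms(1), of g q, folded c_def]
  ultimately show ?thesis
    unfolding c_def[symmetric] unfolding carry_def[of n g "Suc q"] using assms(1)
    by (intro floor_unique) (auto simp: field_simps)
qed

text \<open>The entry at offset \<open>j\<close> from \<open>i\<close> is the bit of block \<open>q + j - k\<close>; for blocks before the
  start of the stream, truncated subtraction makes both carries \<open>0\<close>.\<close>

definition tracks :: "nat \<Rightarrow> nat \<Rightarrow> (nat \<Rightarrow> real) \<Rightarrow> nat \<Rightarrow> summing_state \<Rightarrow> bool" where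
  "tracks n k g N s \<longleftrightarrow> (let q = N div n in
     st_i s = q mod k \<and> st_m s = N mod n \<and>
     st_y s = (\<Sum>i<N. g i) - real n * carry n g q \<and>
     st_B s = carry n g q - carry n g (q - k) \<and>
     length (st_b s) = k \<and>
     (\<forall>j<k. of_bool (st_b s ! ((q + j) mod k)) =
        carry n g (Suc (q + j) - k) - carry n g (q + j - k)))"

lemma tracks_init: "0 < k \<Longrightarrow> tracks n k g 0 (init_state k)"
  by (simp add: tracks_def init_state_def)

lemma tracks_add:
  assumes "0 < n" "0 < k" and W: "W = n * k" and g: "\<And>i. g i \<in> {0..1}"
    and x: "rnd (real x / real R) = g N" and tr: "tracks n k g N s"
  shows "tracks n k g (Suc N) (add_element W R k rnd x s)"
proof -
  define q where "q = N div n"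
  have n: "real W / real k = real n" using W assms(2) by simp
  have s: "st_i s = q mod k" "st_m s = N mod n"
     "st_y s = (\<Sum>i<N. g i) - real n * carry n g q"
     "st_B s = carry n g q - carry n g (q - k)"
     "length (st_b s) = k"
     and b: "\<And>j. j < k \<Longrightarrow> of_bool (st_b s ! ((q + j) mod k)) =
        carry n g (Suc (q + j) - k) - carry n g (q + j - k)"
    using tr by (auto simp: tracks_def Let_def q_def)
  show ?thesis
  proof (cases "Suc (N mod n) = n")
    case True
    have N: "Suc N = Suc q * n"
      using True div_mult_mod_eq[of N n] unfolding q_def mult_Suc by linarith
    have div: "Suc N div n = Suc q" and mod: "Suc N mod n = 0"
      unfolding N using assms(1) by auto
    have rm: "real (N mod n) = real n - 1" using True by linarith
    define bit where "bit \<longleftrightarrow> real n \<le> (\<Sum>i<N. g i) - real n * carry n g q + g N"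
    have c: "carry n g (Suc q) = carry n g q + of_bool bit"
      unfolding carry_Suc[OF assms(1) g] N[symmetric] bit_def by (simp add: algebra_simps)
    define s' where "s' = add_element W R k rnd x s"
    have s': "s' = \<lparr>st_y = (\<Sum>i<N. g i) - real n * carry n g q + g N - real n * of_bool bit,
      st_B = carry n g q - carry n g (q - k) - of_bool (st_b s ! (q mod k)) + of_bool bit,
      st_i = Suc q mod k, st_m = 0, st_b = (st_b s)[q mod k := bit]\<rparr>"
      unfolding s'_def add_element_def n s(1-4) x Let_def bit_def[symmetric]
      using rm by (auto simp: mod_Suc_eq)
    have "of_bool (st_b s' ! ((Suc q + j) mod k)) =
        carry n g (Suc (Suc q + j) - k) - carry n g (Suc q + j - k)" if j: "j < k" for j
    \<comment> \<open>Offset \<open>k - 1\<close> from the new index is the slot just overwritten,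
      now holding the bit of block \<open>q\<close>. Any other offset \<open>j\<close> is the old
      offset \<open>Suc j\<close>, and that slot is untouched because \<open>k\<close> does not
      divide \<open>Suc j\<close>.\<close>
    proof (cases "Suc j = k")
      case True
      then have "Suc q + j = q + k" by simp
      then show ?thesis using assms(2) s(5) c unfolding \<open>Suc q + j = q + k\<close>
        by (simp add: s' Suc_diff_le)
    next
      case False
      then have "Suc j < k" using j by simp
      moreover from this have "(Suc q + j) mod k \<noteq> q mod k"
        using mod_eq_dvd_iff_nat[of q "Suc q + j" k] by (auto dest: dvd_imp_le)
      ultimately show ?thesis using b[of "Suc j"] by (simp add: s')
    qed
    \<comment> \<open>Subtracting the outgoing bit from \<open>B\<close> moves the lower carry from
      \<open>q - k\<close> to \<open>Suc q - k\<close>.\<close>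
    moreover have "of_bool (st_b s ! (q mod k)) = carry n g (Suc q - k) - carry n g (q - k)"
      using b[of 0] assms(2) by simp
    ultimately show ?thesis
      unfolding s'_def[symmetric] tracks_def div mod Let_def
      using c s(5) by (auto simp: s' algebra_simps)
  next
    case False
    have div: "Suc N div n = q" and mod: "Suc N mod n = Suc (N mod n)"
      using False by (simp_all add: div_Suc mod_Suc q_def)
    have "real (N mod n) \<noteq> real n - 1" using False by linarith
    then have "add_element W R k rnd x s = s\<lparr>st_y := st_y s + g N, st_m := st_m s + 1\<rparr>"
      unfolding add_element_def n x Let_def s(2) by simp
    then show ?thesis
      unfolding tracks_def div mod Let_def using s b by simp
  qed
qed

lemma tracks_run:
  assumes "0 < n" "0 < k" "W = n * k" "\<And>i. rnd (real (f i) / real R) \<in> {0..1}"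
  shows "tracks n k (\<lambda>i. rnd (real (f i) / real R)) N (run W R k rnd (map f [0..<N]))"
proof (induction N)
  case 0
  show ?case using tracks_init assms(2) by (simp add: run_def)
next
  case (Suc N)
  have "tracks n k (\<lambda>i. rnd (real (f i) / real R)) (Suc N)
      (add_element W R k rnd (f N) (run W R k rnd (map f [0..<N])))"
    using assms Suc by (intro tracks_add) auto
  then show ?case by (simp add: run_def)
qed

lemma query_error_rounded:
  assumes "0 < n" "0 < k" and W: "W = n * k" and g: "\<And>i. g i \<in> {0..1}"
    and "0 < R" and tr: "tracks n k g N s"
  shows "\<bar>query W R k s / real R - (\<Sum>i=N-W..<N. g i)\<bar> \<le> real n / 2"
proof -
  define q m where "q = N div n" and "m = N mod n"
  have m: "m < n" "N = q * n + m" using assms(1) by (simp_all add: q_def m_def)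
  have n: "real W / real k = real n" "real W / (2 * real k) = real n / 2"
    using W assms(2) by simp_all
  define \<beta> :: int where "\<beta> = of_bool (st_b s ! (q mod k))"
  have \<beta>: "\<beta> = carry n g (Suc q - k) - carry n g (q - k)"
    using tr assms(2) unfolding \<beta>_def tracks_def Let_def q_def[symmetric]
    by (metis add_0_right)
  have "query W R k s / real R = real n * (carry n g q - carry n g (q - k)) +
     ((\<Sum>i<N. g i) - real n * carry n g q) - real n / 2 - real m * \<beta>"
    using tr assms(5) unfolding \<beta>_def tracks_def Let_def q_def[symmetric] m_def[symmetric]
    by (simp add: query_def n)
  moreover have "(\<Sum>i=N-W..<N. g i) = (\<Sum>i<N. g i) - (\<Sum>i<N-W. g i)"
    using sum.atLeastLessThan_concat[of 0 "N - W" N g] by (simp add: lessThan_atLeast0)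
  \<comment> \<open>The terms in \<open>carry n g q\<close> and the full prefix sum cancel, so only
    the data before the window remain.\<close>
  ultimately have err: "query W R k s / real R - (\<Sum>i=N-W..<N. g i) =
      (\<Sum>i<N-W. g i) - real n * carry n g (q - k) - real m * \<beta> - real n / 2"
    by (simp add: algebra_simps)
  show ?thesis
  proof (cases "k \<le> q")
    \<comment> \<open>The window still reaches back to the start: prefix and carries vanish, and the
      error is exactly \<open>- n / 2\<close>.\<close>
    case False
    have "Suc q * n \<le> k * n" using False by (intro mult_le_mono1) simp
    then have "N - W = 0" using m W by (simp add: mult.commute)
    moreover have "\<beta> = 0" using False by (simp add: \<beta>)
    ultimately show ?thesis unfolding err using False by simp
  next
    case True
    define p where "p = q - k"
    \<comment> \<open>The window starts at offset \<open>m\<close> inside block \<open>p\<close>,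
      the block whose bit the query reads.\<close>
    have NW: "N - W = p * n + m"
    proof -
      have "q * n = p * n + W" using True by (simp add: p_def W algebra_simps flip: add_mult_distrib2)
      then show ?thesis using m(2) by simp
    qed
    define c where "c = carry n g p"
    have \<beta>': "\<beta> = carry n g (Suc p) - c" using True by (simp add: \<beta> p_def c_def Suc_diff_le)
    note bnd = carry_bounds[OF assms(1), of g p] carry_Suc[OF assms(1), of g p, OF g]
    have "(\<Sum>i<p * n. g i) \<le> (\<Sum>i<N-W. g i)" "(\<Sum>i<N-W. g i) \<le> (\<Sum>i<p * n. g i) + real m"
      using partial_sum_bounds[OF g, of "p * n" "N - W"] by (auto simp: NW)
    \<comment> \<open>The bit is decided at the end of block \<open>p\<close>. For bit 0 the first
      inequality gives the upper bound \<open>n\<close>; for bit 1 the second gives the lower bound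
      \<open>m\<close>.\<close>
    moreover have "(\<Sum>i<N-W. g i) \<le> (\<Sum>i<Suc p * n. g i)"
      "(\<Sum>i<Suc p * n. g i) \<le> (\<Sum>i<N-W. g i) + (real n - real m)"
      using partial_sum_bounds[OF g, of "N - W" "Suc p * n"] m(1)
      by (auto simp: NW of_nat_diff)
    moreover define X where "X = real n * real_of_int c"
    ultimately have "0 \<le> (\<Sum>i<N-W. g i) - X - real m * \<beta> \<and>
        (\<Sum>i<N-W. g i) - X - real m * \<beta> \<le> real n"
      using bnd[folded c_def, folded X_def] unfolding \<beta>'
      by (cases "real n \<le> (\<Sum>i<Suc p * n. g i) - X") (simp_all del: mult_Suc)
    then show ?thesis
      unfolding err p_def[symmetric] c_def[symmetric] X_def[symmetric] abs_le_iff by argo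
  qed
qed

lemma window_sum_map: "window_sum W (map f [0..<N]) = (\<Sum>i=N-W..<N. f i)"
  by (simp add: window_sum_def drop_map interv_sum_list_conv_sum_set_nat)

theorem theorem15:
  fixes W R k :: nat and \<epsilon> :: real and \<upsilon> :: int and rnd :: "real \<Rightarrow> real"
  assumes "1 < W" and "0 < R" and "0 < \<epsilon>"
    and "1 / \<epsilon> \<le> 2 * real W * (1 - 1 / log 2 (real W))"
    and "\<upsilon> = \<lceil>log 2 (1 / \<epsilon> * log 2 (real W))\<rceil>"
    and "int k = \<lceil>1 / (2 * \<epsilon> - 2 powi (- \<upsilon>))\<rceil>"
    and "real W / real k \<in> \<int>"
    and "is_rounding \<upsilon> rnd"
  shows "additive_approximation W R (real R * real W * \<epsilon>)
           (\<lambda>xs. query W R k (run W R k rnd xs))"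
  unfolding additive_approximation_def
proof (intro allI impI)
  fix xs :: "nat list" assume xs: "set xs \<subseteq> {0..R}"
  define \<delta> :: real where "\<delta> = 2 powi (- \<upsilon>)"
  note k = block_count_bounds[OF assms(1,3-6), folded \<delta>_def]
  obtain z where z: "real W / real k = of_int z" using assms(7) by (auto elim: Ints_cases)
  define n where "n = nat z"
  have "0 < real_of_int z" unfolding z[symmetric] using k(1) assms(1) by simp
  then have n0: "0 < n" and zn: "real_of_int z = real n" by (simp_all add: n_def)
  have "real W = real (n * k)" using z zn k(1) by (simp add: field_simps)
  then have W: "W = n * k" by (simp only: of_nat_eq_iff)
  define N where "N = length xs"
  \<comment> \<open>Padding with 0 makes the list a function on all naturals, since the invariant is
    stated for such functions.\<close>
  define f where "f i = (if i < N then xs ! i else 0)" for i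
  have xs_eq: "xs = map f [0..<N]" by (rule nth_equalityI) (auto simp: f_def N_def)
  have "f i \<le> R" for i using xs by (auto simp: f_def N_def dest: nth_mem)
  then have unit: "real (f i) / real R \<in> {0..1}" for i using assms(2) by simp
  define g where "g i = rnd (real (f i) / real R)" for i
  have g: "g i \<in> {0..1}" for i
    using assms(8) unit unfolding g_def is_rounding_def by blast
  define Q where "Q = query W R k (run W R k rnd xs)"
  have "tracks n k g N (run W R k rnd xs)"
    unfolding xs_eq g_def using tracks_run[OF n0 k(1) W] g unfolding g_def by blast
  then have e1: "\<bar>Q / real R - (\<Sum>i=N-W..<N. g i)\<bar> \<le> real n / 2"
    unfolding Q_def by (rule query_error_rounded[OF n0 k(1) W g assms(2)])
  have "\<bar>(\<Sum>i=N-W..<N. g i) - (\<Sum>i=N-W..<N. real (f i) / real R)\<bar>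
      \<le> (\<Sum>i=N-W..<N. \<bar>g i - real (f i) / real R\<bar>)"
    unfolding sum_subtractf[symmetric] by (rule sum_abs)
  also have "\<dots> \<le> real (card {N-W..<N}) * (\<delta> / 2)"
    unfolding g_def \<delta>_def by (intro sum_bounded_above rounding_error assms(8) unit)
  also have "\<dots> \<le> real W * (\<delta> / 2)"
    by (intro mult_right_mono) (auto simp: \<delta>_def)
  finally have e2: "\<bar>(\<Sum>i=N-W..<N. g i) - real (window_sum W xs) / real R\<bar> \<le> real W * (\<delta> / 2)"
    by (simp add: xs_eq window_sum_map sum_divide_distrib)
  \<comment> \<open>Half a block is \<open>W / (2 * k)\<close>, so the bound on \<open>1 / k\<close>
    lets both errors together fit into \<open>W * \<epsilon>\<close>.\<close>
  have "real n / 2 + real W * (\<delta> / 2) = real W * ((1 / real k + \<delta>) / 2)"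
    using W k(1) by (simp add: field_simps)
  also have "\<dots> \<le> real W * \<epsilon>" using k(3) by (intro mult_left_mono) auto
  finally have e: "\<bar>Q / real R - real (window_sum W xs) / real R\<bar> \<le> real W * \<epsilon>"
    using e1 e2 by linarith
  have "\<bar>Q - real (window_sum W xs)\<bar> = real R * \<bar>Q / real R - real (window_sum W xs) / real R\<bar>"
    using assms(2) by (simp flip: diff_divide_distrib)
  also have "\<dots> \<le> real R * (real W * \<epsilon>)" using e by (intro mult_left_mono) auto
  finally show "\<bar>query W R k (run W R k rnd xs) - real (window_sum W xs)\<bar> \<le> real R * real W * \<epsilon>"
    by (simp add: Q_def mult.assoc)
qed

end
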